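(* Let $n\ge 3$, let $z_1,\dots,z_n$ be non-negative integers (not necessarily distinct), let $X$ be the set of all $n$-tuples obtained by permuting the coordinates of $(z_1,\dots,z_n)$, and let $(\phi,V)$ be the representation of the braid group $\mathbb{B}_n$ on the complex inner product space $V$ with orthonormal basis $\{v_x : x\in X\}$ given by $\phi(\tau_k)(v_x)=q_{x_k,x_{k+1}}v_{\sigma_k(x)}$ for $1\le k\le n-1$, $x\in X$, where the $q_{a,b}$ are non-zero complex numbers. Suppose that $\phi(\tau_k)$ is a self-adjoint operator for all $k$, $1\le k\le n-1$, and that for any pair $x,y\in X$ with $x\ne y$ there exists $j$, $1\le j\le n-1$, such that $|q_{x_j,x_{j+1}}|^2\neq |q_{y_j,y_{j+1}}|^2$. Then $(\phi,V)$ is an irreducible representation of $\mathbb{B}_n$.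
   Context: The braid group $\mathbb{B}_n$ on $n$ strings is the group with generators $\tau_1,\dots,\tau_{n-1}$ and relations $\tau_k\tau_j=\tau_j\tau_k$ if $|k-j|>1$, and $\tau_k\tau_{k+1}\tau_k=\tau_{k+1}\tau_k\tau_{k+1}$ for $1\le k\le n-2$. A representation of $\mathbb{B}_n$ is a pair $(\phi,V)$ with $V$ a finite dimensional complex vector space and $\phi:\mathbb{B}_n\to\operatorname{Aut}(V)$ a group homomorphism. For $x=(x_1,\dots,x_n)\in X$, $\sigma_k(x)=(x_1,\dots,x_{k-1},x_{k+1},x_k,x_{k+2},\dots,x_n)$. For all values $a,b$ that occur as consecutive coordinates $(x_k,x_{k+1})=(a,b)$ of some $x\in X$, a non-zero complex number $q_{a,b}$ is fixed, depending only on the ordered pair of values $(a,b)$; the formula $\phi(\tau_k)(v_x)=q_{x_k,x_{k+1}}v_{\sigma_k(x)}$ then does define a representation of $\mathbb{B}_n$. Self-adjointness is with respect to the inner product for which $\{v_x : x\in X\}$ is orthonormal. *)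

theory Defs
  imports Complex_Main "HOL-Algebra.Group" "HOL-Combinatorics.Permutations"
begin

section \<open>The braid group on n strings\<close>

text \<open>The letter \<open>(k, True)\<close> stands for the k-th generator, \<open>(k, False)\<close> for its
  inverse; generators are numbered from 1 to \<open>n - 1\<close>.\<close>

type_synonym braid_word = "(nat \<times> bool) list"

definition braid_words :: "nat \<Rightarrow> braid_word set" where
  "braid_words n = lists ({1..n - 1} \<times> UNIV)"

inductive braid_eq :: "nat \<Rightarrow> braid_word \<Rightarrow> braid_word \<Rightarrow> bool" for n :: nat where
  refl: "w \<in> braid_words n \<Longrightarrow> braid_eq n w w"
| sym: "braid_eq n w w' \<Longrightarrow> braid_eq n w' w"
| trans: "braid_eq n w w' \<Longrightarrow> braid_eq n w' w'' \<Longrightarrow> braid_eq n w w''"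
| append: "braid_eq n u u' \<Longrightarrow> braid_eq n w w' \<Longrightarrow> braid_eq n (u @ w) (u' @ w')"
| cancel: "k \<in> {1..n - 1} \<Longrightarrow> braid_eq n [(k, b), (k, \<not> b)] []"
| far: "k \<in> {1..n - 1} \<Longrightarrow> j \<in> {1..n - 1} \<Longrightarrow> \<bar>int k - int j\<bar> > 1 \<Longrightarrow>
    braid_eq n [(k, True), (j, True)] [(j, True), (k, True)]"
| braid: "1 \<le> k \<Longrightarrow> k + 2 \<le> n \<Longrightarrow>
    braid_eq n [(k, True), (k + 1, True), (k, True)] [(k + 1, True), (k, True), (k + 1, True)]"

definition braid_class :: "nat \<Rightarrow> braid_word \<Rightarrow> braid_word set" where
  "braid_class n w = {w'. braid_eq n w w'}"

definition braid_group :: "nat \<Rightarrow> braid_word set monoid" where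
  "braid_group n = \<lparr>carrier = braid_class n ` braid_words n,
     monoid.mult = (\<lambda>A B. \<Union>a\<in>A. \<Union>b\<in>B. braid_class n (a @ b)),
     one = braid_class n []\<rparr>"

definition braid_gen :: "nat \<Rightarrow> nat \<Rightarrow> braid_word set" where
  "braid_gen n k = braid_class n [(k, True)]"

lemma braid_eq_words: "braid_eq n w w' \<Longrightarrow> w \<in> braid_words n \<and> w' \<in> braid_words n"
  by (induction rule: braid_eq.induct) (auto simp: braid_words_def)

lemma braid_class_eq_iff:
  assumes w: "w \<in> braid_words n"
  shows "braid_class n w = braid_class n w' \<longleftrightarrow> braid_eq n w w'"
proof
  assume "braid_class n w = braid_class n w'"
  then have "braid_eq n w' w"
    using braid_eq.refl[OF w] by (auto simp: braid_class_def)
  then show "braid_eq n w w'" by (rule braid_eq.sym)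
next
  assume e: "braid_eq n w w'"
  show "braid_class n w = braid_class n w'"
    unfolding braid_class_def
    using braid_eq.trans[OF e] braid_eq.trans[OF braid_eq.sym[OF e]] by blast
qed

lemma braid_mult_class:
  assumes "u \<in> braid_words n" "w \<in> braid_words n"
  shows "braid_class n u \<otimes>\<^bsub>braid_group n\<^esub> braid_class n w = braid_class n (u @ w)"
proof -
  have eq: "braid_class n (a @ b) = braid_class n (u @ w)"
    if "a \<in> braid_class n u" "b \<in> braid_class n w" for a b
  proof -
    have "braid_eq n (u @ w) (a @ b)"
      using that by (auto simp: braid_class_def intro: braid_eq.append)
    then show ?thesis
      using braid_class_eq_iff[of "u @ w" n "a @ b"] braid_eq_words by auto
  qed
  moreover have "u \<in> braid_class n u" "w \<in> braid_class n w"
    using assms by (auto simp: braid_class_def intro: braid_eq.refl)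
  ultimately have "(\<Union>a\<in>braid_class n u. \<Union>b\<in>braid_class n w. braid_class n (a @ b))
      = braid_class n (u @ w)"
    by blast
  then show ?thesis
    by (simp add: braid_group_def)
qed

lemma braid_words_append:
  "u \<in> braid_words n \<Longrightarrow> w \<in> braid_words n \<Longrightarrow> u @ w \<in> braid_words n"
  by (auto simp: braid_words_def)

lemma Nil_braid_words: "[] \<in> braid_words n"
  by (simp add: braid_words_def)

lemma braid_left_inverse:
  "w \<in> braid_words n \<Longrightarrow> \<exists>w'\<in>braid_words n. braid_eq n (w' @ w) []"
proof (induction w)
  case Nil
  then show ?case by (auto intro!: bexI[of _ "[]"] braid_eq.refl)
next
  case (Cons l w)
  obtain k b where l: "l = (k, b)" by (cases l)
  have k: "k \<in> {1..n - 1}" and w: "w \<in> braid_words n"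
    using Cons.prems by (auto simp: braid_words_def l)
  obtain w' where w': "w' \<in> braid_words n" "braid_eq n (w' @ w) []"
    using Cons.IH[OF w] by blast
  have "braid_eq n ([(k, \<not> b), (k, b)] @ w) ([] @ w)"
    using braid_eq.append[OF braid_eq.cancel[OF k, of "\<not> b"] braid_eq.refl[OF w]] by simp
  then have "braid_eq n (w' @ [(k, \<not> b), (k, b)] @ w) (w' @ w)"
    using braid_eq.append[OF braid_eq.refl[OF w'(1)]] by fastforce
  then have "braid_eq n ((w' @ [(k, \<not> b)]) @ l # w) []"
    using braid_eq.trans[OF _ w'(2)] by (simp add: l)
  moreover have "w' @ [(k, \<not> b)] \<in> braid_words n"
    using w'(1) k by (auto simp: braid_words_def)
  ultimately show ?case by blast
qed

lemma group_braid_group: "group (braid_group n)"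
proof (rule groupI)
  have carr: "carrier (braid_group n) = braid_class n ` braid_words n"
    and one: "\<one>\<^bsub>braid_group n\<^esub> = braid_class n []"
    by (simp_all add: braid_group_def)
  show "x \<otimes>\<^bsub>braid_group n\<^esub> y \<in> carrier (braid_group n)"
    if "x \<in> carrier (braid_group n)" "y \<in> carrier (braid_group n)" for x y
    using that by (auto simp: carr braid_mult_class braid_words_append)
  show "\<one>\<^bsub>braid_group n\<^esub> \<in> carrier (braid_group n)"
    by (simp add: carr one Nil_braid_words)
  show "x \<otimes>\<^bsub>braid_group n\<^esub> y \<otimes>\<^bsub>braid_group n\<^esub> z
      = x \<otimes>\<^bsub>braid_group n\<^esub> (y \<otimes>\<^bsub>braid_group n\<^esub> z)"
    if "x \<in> carrier (braid_group n)" "y \<in> carrier (braid_group n)"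
      "z \<in> carrier (braid_group n)" for x y z
    using that by (auto simp: carr braid_mult_class braid_words_append)
  show "\<one>\<^bsub>braid_group n\<^esub> \<otimes>\<^bsub>braid_group n\<^esub> x = x" if "x \<in> carrier (braid_group n)" for x
    using that by (auto simp: carr one braid_mult_class Nil_braid_words)
  show "\<exists>y\<in>carrier (braid_group n). y \<otimes>\<^bsub>braid_group n\<^esub> x = \<one>\<^bsub>braid_group n\<^esub>"
    if x: "x \<in> carrier (braid_group n)" for x
  proof -
    obtain w where w: "w \<in> braid_words n" "x = braid_class n w"
      using x carr by auto
    obtain w' where w': "w' \<in> braid_words n" "braid_eq n (w' @ w) []"
      using braid_left_inverse[OF w(1)] by blast
    then have "braid_class n w' \<otimes>\<^bsub>braid_group n\<^esub> x = \<one>\<^bsub>braid_group n\<^esub>"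
      using w braid_class_eq_iff[of "w' @ w" n "[]"]
      by (simp add: one braid_mult_class braid_words_append)
    then show ?thesis using w'(1) carr by blast
  qed
qed


section \<open>Representations and irreducibility\<close>

text \<open>The vector space V is the whole type \<open>'v\<close> with scalar multiplication \<open>scale\<close>.\<close>

definition aut_group :: "(complex \<Rightarrow> 'v::ab_group_add \<Rightarrow> 'v) \<Rightarrow> ('v \<Rightarrow> 'v) monoid" where
  "aut_group scale = \<lparr>carrier = {T. Vector_Spaces.linear scale scale T \<and> bij T},
     monoid.mult = (\<circ>), one = id\<rparr>"

definition braid_representation ::
    "nat \<Rightarrow> (complex \<Rightarrow> 'v::ab_group_add \<Rightarrow> 'v) \<Rightarrow> (braid_word set \<Rightarrow> 'v \<Rightarrow> 'v) \<Rightarrow> bool" where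
  "braid_representation n scale \<phi> \<longleftrightarrow>
     vector_space scale \<and>
     (\<exists>B. finite B \<and> module.span scale B = UNIV) \<and>
     \<phi> \<in> hom (braid_group n) (aut_group scale)"

definition irreducible_braid_representation ::
    "nat \<Rightarrow> (complex \<Rightarrow> 'v::ab_group_add \<Rightarrow> 'v) \<Rightarrow> (braid_word set \<Rightarrow> 'v \<Rightarrow> 'v) \<Rightarrow> bool" where
  "irreducible_braid_representation n scale \<phi> \<longleftrightarrow>
     braid_representation n scale \<phi> \<and>
     (UNIV :: 'v set) \<noteq> {0} \<and>
     (\<forall>W. module.subspace scale W \<and> (\<forall>g\<in>carrier (braid_group n). \<phi> g ` W \<subseteq> W)
        \<longrightarrow> W = {0} \<or> W = UNIV)"


section \<open>Complex inner product spaces\<close>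

text \<open>The inner product is linear in its first argument. Hermitian symmetry makes
  \<open>ip u u\<close> real, so positivity is stated for its real part.\<close>

locale complex_inner_product_space = vector_space scale
  for scale :: "complex \<Rightarrow> 'v::ab_group_add \<Rightarrow> 'v" +
  fixes ip :: "'v \<Rightarrow> 'v \<Rightarrow> complex"
  assumes ip_add_left: "ip (u + v) w = ip u w + ip v w"
    and ip_scale_left: "ip (scale c u) w = c * ip u w"
    and ip_commute: "ip w u = cnj (ip u w)"
    and ip_pos: "u \<noteq> 0 \<Longrightarrow> Re (ip u u) > 0"

definition orthonormal_basis ::
    "(complex \<Rightarrow> 'v::ab_group_add \<Rightarrow> 'v) \<Rightarrow> ('v \<Rightarrow> 'v \<Rightarrow> complex) \<Rightarrow> 'i set \<Rightarrow> ('i \<Rightarrow> 'v) \<Rightarrow> bool" where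
  "orthonormal_basis scale ip I v \<longleftrightarrow>
     (\<forall>x\<in>I. \<forall>y\<in>I. ip (v x) (v y) = (if x = y then 1 else 0)) \<and>
     module.span scale (v ` I) = UNIV"

definition self_adjoint :: "('v \<Rightarrow> 'v \<Rightarrow> complex) \<Rightarrow> ('v \<Rightarrow> 'v) \<Rightarrow> bool" where
  "self_adjoint ip T \<longleftrightarrow> (\<forall>u w. ip (T u) w = ip u (T w))"


section \<open>Tuples\<close>

text \<open>An n-tuple is a list of length n; list positions start at 0, so the k-th coordinate
  of \<open>x\<close> is \<open>x ! (k - 1)\<close>.\<close>

definition coord :: "'a list \<Rightarrow> nat \<Rightarrow> 'a" where
  "coord x k = x ! (k - 1)"

definition tuple_perms :: "'a list \<Rightarrow> 'a list set" where
  "tuple_perms z = {permute_list p z | p. p permutes {..<length z}}"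

definition swap_coords :: "nat \<Rightarrow> 'a list \<Rightarrow> 'a list" where
  "swap_coords k x = x[k - 1 := coord x (k + 1), k := coord x k]"

end

theory Submission
  imports Defs
begin

text \<open>Self-adjointness forces \<open>q b a = cnj (q a b)\<close>, so the square of each generator is diagonal
  in the basis \<open>v\<close>, with eigenvalue \<open>|q (coord x k) (coord x (k + 1))|\<^sup>2\<close> at \<open>v x\<close>. By hypothesis
  the joint eigenvalues separate the basis vectors, so a nonzero invariant subspace contains some
  \<open>v x\<close>. The generators permute the basis lines by adjacent transpositions, hence transitively.\<close>

text \<open>Adjacent transpositions connect all rearrangements of a list. Induction on the target
  \<open>ys\<close>: its head is found in the current list, carried leftwards to the front and
  absorbed into the prefix \<open>us\<close>, which is therefore arbitrary in the induction.\<close>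

lemma adjacent_swaps_closed:
  assumes swap: "\<And>as a b bs. P (as @ a # b # bs) \<Longrightarrow> P (as @ b # a # bs)"
    and "mset xs = mset ys" and "P (us @ xs)"
  shows "P (us @ ys)"
  using assms(2,3)
proof (induction ys arbitrary: us xs)
  case Nil
  then show ?case by simp
next
  case (Cons y ys)
  \<comment> \<open>Reverse induction fits because \<open>y\<close> first passes the last entry of
    \<open>as\<close>, which then joins \<open>bs\<close>.\<close>
  have to_front: "P (us @ y # as @ bs)" if "P (us @ as @ y # bs)" for as bs
    using that
  proof (induction as arbitrary: bs rule: rev_induct)
    case Nil
    then show ?case by simp
  next
    case (snoc a as)
    show ?case
      using snoc.IH[of "a # bs"] snoc.prems swap[of "us @ as" a y bs] by simp
  qed
  have "y \<in> set xs"
    using Cons.prems(1) by (metis list.set_intros(1) set_mset_mset)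
  then obtain as bs where xs: "xs = as @ y # bs"
    by (meson split_list)
  show ?case
    using Cons.IH[of "as @ bs" "us @ [y]"] Cons.prems to_front[of as bs] xs by simp
qed

lemma swap_coords_append: "swap_coords (length as + 1) (as @ a # b # bs) = as @ b # a # bs"
  by (simp add: swap_coords_def coord_def nth_append list_update_append)

lemma swap_coords_swaps:
  assumes "1 \<le> k" and "k < length x"
  shows "coord (swap_coords k x) k = coord x (k + 1)"
    and "coord (swap_coords k x) (k + 1) = coord x k"
    and "swap_coords k (swap_coords k x) = x"
    and "mset (swap_coords k x) = mset x"
proof -
  \<comment> \<open>Splitting \<open>x\<close> around positions \<open>k\<close> and
    \<open>k + 1\<close> turns all four claims into computations with
    \<open>swap_coords_append\<close>.\<close>
  define as bs where "as = take (k - 1) x" and "bs = drop (k + 1) x"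
  have "x = as @ coord x k # coord x (k + 1) # bs" and k: "k = length as + 1"
    using assms id_take_nth_drop[of "k - 1" x] by (auto simp: as_def bs_def coord_def Cons_nth_drop_Suc)
  then obtain a b where x: "x = as @ a # b # bs"
    by blast
  show "coord (swap_coords k x) k = coord x (k + 1)"
    and "coord (swap_coords k x) (k + 1) = coord x k"
    and "swap_coords k (swap_coords k x) = x"
    and "mset (swap_coords k x) = mset x"
    unfolding x k swap_coords_append by (simp_all add: coord_def nth_append)
qed

lemma tuple_perms_eq_mset: "tuple_perms z = {x. mset x = mset z}"
  by (auto simp: tuple_perms_def mset_permute_list) (metis mset_eq_permutation)

lemma finite_tuple_perms: "finite (tuple_perms z)"
  unfolding tuple_perms_def by (simp add: finite_permutations)

lemma braid_gen_carrier:
  assumes "1 \<le> k" and "k \<le> n - 1"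
  shows "braid_gen n k \<in> carrier (braid_group n)"
  using assms by (auto simp: braid_gen_def braid_group_def braid_words_def)

context complex_inner_product_space
begin

lemma ip_add_right: "ip w (u + u') = ip w u + ip w u'"
  by (metis ip_add_left ip_commute complex_cnj_add)

lemma ip_scale_right: "ip w (scale c u) = cnj c * ip w u"
  by (metis ip_scale_left ip_commute complex_cnj_mult)

lemma ip_diff_left: "ip (u - u') w = ip u w - ip u' w"
  using ip_add_left[of "u - u'" u' w] by simp

text \<open>Orthogonality passes from \<open>S\<close> to its span, hence to \<open>w\<close>
  itself, and positivity then forces \<open>w = 0\<close>.\<close>

lemma eq_0_if_orthogonal_to_spanning:
  assumes "span S = UNIV" and orth: "\<And>s. s \<in> S \<Longrightarrow> ip w s = 0"
  shows "w = 0"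
proof -
  have "ip w u = 0" if "u \<in> span S" for u
    using that
  proof (induction rule: span_induct_alt)
    case base
    show ?case using ip_scale_right[of w 0 0] by simp
  next
    case (step c x y)
    then show ?case by (simp add: ip_add_right ip_scale_right orth)
  qed
  then have "ip w w = 0"
    using assms(1) by simp
  then show ?thesis
    using ip_pos[of w] by force
qed

text \<open>Minimal support argument: a nonzero vector of \<open>W\<close> with fewest nonzero
  coefficients has only one, since otherwise an operator separating two of its basis vectors would
  produce a shorter nonzero vector in \<open>W\<close>.\<close>

lemma basis_vector_in_subspace:
  assumes basis: "orthonormal_basis scale ip X v" and "finite X"
    and W: "subspace W" and "W \<noteq> {0}"
    and inv: "\<And>j u. j \<in> J \<Longrightarrow> u \<in> W \<Longrightarrow> D j u \<in> W"
    and diag: "\<And>j u x. j \<in> J \<Longrightarrow> x \<in> X \<Longrightarrow> ip (D j u) (v x) = d j x * ip u (v x)"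
    and sep: "\<And>x y. x \<in> X \<Longrightarrow> y \<in> X \<Longrightarrow> x \<noteq> y \<Longrightarrow> \<exists>j\<in>J. d j x \<noteq> d j y"
  shows "\<exists>x\<in>X. v x \<in> W"
proof -
  have ortho: "ip (v x) (v y) = (if x = y then 1 else 0)" if "x \<in> X" "y \<in> X" for x y
    using basis that by (simp add: orthonormal_basis_def)
  have zeroI: "w = 0" if "\<And>x. x \<in> X \<Longrightarrow> ip w (v x) = 0" for w
    using eq_0_if_orthogonal_to_spanning[of "v ` X" w] basis that
    by (auto simp: orthonormal_basis_def)
  define supp where "supp w = {x \<in> X. ip w (v x) \<noteq> 0}" for w
  have fin: "finite (supp w)" for w
    using \<open>finite X\<close> by (simp add: supp_def)
  obtain w0 where "w0 \<in> W - {0}"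
    using \<open>W \<noteq> {0}\<close> subspace_0[OF W] by blast
  then obtain w where w: "w \<in> W" "w \<noteq> 0"
    and min: "\<And>u. u \<in> W - {0} \<Longrightarrow> card (supp w) \<le> card (supp u)"
    using arg_min_nat_lemma[of "\<lambda>w. w \<in> W - {0}" w0 "\<lambda>w. card (supp w)"] by blast
  obtain x where x: "x \<in> X" "ip w (v x) \<noteq> 0"
    using zeroI w(2) by blast
  have only: "ip w (v y) = 0" if y: "y \<in> X" "y \<noteq> x" for y
  proof (rule ccontr)
    assume wy: "ip w (v y) \<noteq> 0"
    obtain j where j: "j \<in> J" "d j x \<noteq> d j y"
      using sep x(1) y by metis
    \<comment> \<open>This kills the coefficient at \<open>y\<close>, keeps the one at
      \<open>x\<close> nonzero and creates no new ones.\<close>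
    define u where "u = D j w - scale (d j y) w"
    have ip_u: "ip u (v t) = (d j t - d j y) * ip w (v t)" if "t \<in> X" for t
      using j(1) that by (simp add: u_def ip_diff_left ip_scale_left diag algebra_simps)
    have "u \<noteq> 0"
      \<comment> \<open>The instance at \<open>0 - 0\<close> supplies
        \<open>ip 0 (v x) = 0\<close>.\<close>
      using ip_u[OF x(1)] x(2) j(2) ip_diff_left[of 0 0 "v x"] by auto
    moreover have "u \<in> W"
      unfolding u_def by (intro subspace_diff[OF W] subspace_scale[OF W] inv j(1) w(1))
    ultimately have "card (supp w) \<le> card (supp u)"
      using min by blast
    moreover have "supp u \<subseteq> supp w" and "y \<in> supp w - supp u"
      using ip_u wy y(1) by (auto simp: supp_def)
    then have "supp u \<subset> supp w"
      by blast
    ultimately show False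
      using psubset_card_mono[OF fin] by (meson not_le)
  qed
  have "w - scale (ip w (v x)) (v x) = 0"
    by (rule zeroI) (use only x(1) in \<open>auto simp: ip_diff_left ip_scale_left ortho\<close>)
  then have "v x = scale (inverse (ip w (v x))) w"
    using x(2) by (metis eq_iff_diff_eq_0 left_inverse scale_one scale_scale)
  then show ?thesis
    using x(1) subspace_scale[OF W w(1)] by metis
qed

end

theorem theorem2p2:
  fixes n :: nat
    and z :: "nat list"
    and X :: "nat list set"
    and scale :: "complex \<Rightarrow> 'v::ab_group_add \<Rightarrow> 'v"
    and ip :: "'v \<Rightarrow> 'v \<Rightarrow> complex"
    and v :: "nat list \<Rightarrow> 'v"
    and q :: "nat \<Rightarrow> nat \<Rightarrow> complex"
    and \<phi> :: "braid_word set \<Rightarrow> 'v \<Rightarrow> 'v"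
  assumes "n \<ge> 3"
    and "length z = n"
    and "X = tuple_perms z"
    and "complex_inner_product_space scale ip"
    and "orthonormal_basis scale ip X v"
    and "\<And>x k. x \<in> X \<Longrightarrow> 1 \<le> k \<Longrightarrow> k \<le> n - 1 \<Longrightarrow> q (coord x k) (coord x (k + 1)) \<noteq> 0"
    and "braid_representation n scale \<phi>"
    and "\<And>k x. 1 \<le> k \<Longrightarrow> k \<le> n - 1 \<Longrightarrow> x \<in> X \<Longrightarrow>
           \<phi> (braid_gen n k) (v x) = scale (q (coord x k) (coord x (k + 1))) (v (swap_coords k x))"
    and "\<And>k. 1 \<le> k \<Longrightarrow> k \<le> n - 1 \<Longrightarrow> self_adjoint ip (\<phi> (braid_gen n k))"
    and "\<And>x y. x \<in> X \<Longrightarrow> y \<in> X \<Longrightarrow> x \<noteq> y \<Longrightarrow>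
           \<exists>j. 1 \<le> j \<and> j \<le> n - 1 \<and>
             (cmod (q (coord x j) (coord x (j + 1))))\<^sup>2 \<noteq> (cmod (q (coord y j) (coord y (j + 1))))\<^sup>2"
  shows "irreducible_braid_representation n scale \<phi>"
proof -
  interpret complex_inner_product_space scale ip by fact
  define T where "T k = \<phi> (braid_gen n k)" for k
  define J where "J = {1..n - 1}"
  have X: "X = {x. mset x = mset z}"
    using assms(3) tuple_perms_eq_mset by simp
  have fin: "finite X"
    using assms(3) finite_tuple_perms by simp
  have z: "z \<in> X"
    by (simp add: X)
  have len: "length x = n" if "x \<in> X" for x
    using that assms(2) X by (metis mem_Collect_eq size_mset)
  have in_range: "1 \<le> k" "k < length x" if "k \<in> J" "x \<in> X" for k x
    using that len[OF that(2)] by (auto simp: J_def)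
  \<comment> \<open>Both range facts carry the premises \<open>k \<in> J\<close> and
    \<open>x \<in> X\<close>, so each fact in \<open>swaps\<close> takes this pair twice.\<close>
  note swaps = swap_coords_swaps[OF in_range]
  have swap_X: "swap_coords k x \<in> X" if "k \<in> J" "x \<in> X" for k x
    using swaps(4)[OF that(1,2,1,2)] that(2) by (simp add: X)
  have ortho: "ip (v x) (v y) = (if x = y then 1 else 0)" if "x \<in> X" "y \<in> X" for x y
    using assms(5) that by (simp add: orthonormal_basis_def)
  have spans: "span (v ` X) = UNIV"
    using assms(5) by (simp add: orthonormal_basis_def)
  have T_v: "T k (v x) = scale (q (coord x k) (coord x (k + 1))) (v (swap_coords k x))"
    if "k \<in> J" "x \<in> X" for k x
    using assms(8) that by (simp add: T_def J_def)
  have self_adj: "ip (T k u) w = ip u (T k w)" if "k \<in> J" for k u w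
    using assms(9) that by (simp add: T_def J_def self_adjoint_def)
  have T_scale: "T k (scale c u) = scale c (T k u)" if "k \<in> J" for k c u
  proof -
    have "T k \<in> carrier (aut_group scale)"
      using assms(7) braid_gen_carrier[of k n] that
      by (auto simp: braid_representation_def hom_def T_def J_def)
    then show ?thesis
      by (simp add: aut_group_def module_hom.scale module_hom_iff_linear)
  qed
  \<comment> \<open>Self-adjointness is read off from one matrix entry, between \<open>v x\<close>
    and its image vector; when the two coordinates agree, it says that the weight is real.\<close>
  have q_sym: "q (coord x (k + 1)) (coord x k) = cnj (q (coord x k) (coord x (k + 1)))"
    if kx: "k \<in> J" "x \<in> X" for k x
  proof -
    let ?y = "swap_coords k x"
    note y = swap_X[OF kx]
    have "q (coord x k) (coord x (k + 1)) = ip (T k (v x)) (v ?y)"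
      using kx y by (simp add: T_v ip_scale_left ortho)
    also have "\<dots> = ip (v x) (T k (v ?y))"
      by (rule self_adj[OF kx(1)])
    also have "\<dots> = cnj (q (coord x (k + 1)) (coord x k))"
      using T_v[OF kx(1) y] kx swaps[OF kx kx] by (simp add: ip_scale_right ortho)
    finally show ?thesis
      by simp
  qed
  define d where "d k x = complex_of_real ((cmod (q (coord x k) (coord x (k + 1))))\<^sup>2)" for k x
  \<comment> \<open>Swapping twice returns to \<open>x\<close>, and by \<open>q_sym\<close> the two
    weights multiply to a squared modulus.\<close>
  have T2_v: "T k (T k (v x)) = scale (d k x) (v x)" if kx: "k \<in> J" "x \<in> X" for k x
    using T_v[OF kx] T_v[OF kx(1) swap_X[OF kx]] swaps[OF kx kx] q_sym[OF kx]
    by (simp add: T_scale[OF kx(1)] d_def complex_norm_square[symmetric])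
  have all: "W = UNIV" if W: "subspace W" "W \<noteq> {0}"
    and inv: "\<forall>g\<in>carrier (braid_group n). \<phi> g ` W \<subseteq> W" for W
  proof -
    have T_W: "T k u \<in> W" if "k \<in> J" "u \<in> W" for k u
      using inv braid_gen_carrier[of k n] that by (auto simp: T_def J_def)
    have "\<exists>x\<in>X. v x \<in> W"
    proof (rule basis_vector_in_subspace[OF assms(5) fin W,
          where J = J and D = "\<lambda>k u. T k (T k u)" and d = d])
      show "T k (T k u) \<in> W" if "k \<in> J" "u \<in> W" for k u
        using that T_W by blast
      show "ip (T k (T k u)) (v x) = d k x * ip u (v x)" if "k \<in> J" "x \<in> X" for k u x
        \<comment> \<open>Self-adjointness moves both factors onto \<open>v x\<close>; the
          eigenvalue comes out conjugated, which is harmless because it is real.\<close>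
        using that by (simp add: self_adj T2_v ip_scale_right) (simp add: d_def)
      show "\<exists>k\<in>J. d k x \<noteq> d k y" if "x \<in> X" "y \<in> X" "x \<noteq> y" for x y
        using assms(10)[OF that] unfolding J_def d_def of_real_eq_iff by auto
    qed
    then obtain x where x: "x \<in> X" "v x \<in> W"
      by blast
    \<comment> \<open>Invariance gives only a multiple of the swapped basis vector; its nonzero
      weight can be divided out.\<close>
    have swap_W: "v (swap_coords k y) \<in> W" if "k \<in> J" "y \<in> X" "v y \<in> W" for k y
    proof -
      let ?c = "q (coord y k) (coord y (k + 1))"
      have "?c \<noteq> 0"
        using assms(6) that by (simp add: J_def)
      then have "v (swap_coords k y) = scale (inverse ?c) (T k (v y))"
        using that by (simp add: T_v)
      then show ?thesis
        using subspace_scale[OF W(1) T_W[OF that(1,3)]] by metis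
    qed
    have "v y \<in> W" if "y \<in> X" for y
    proof -
      \<comment> \<open>The empty prefix matches the shape of \<open>adjacent_swaps_closed\<close>;
        membership in \<open>X\<close> is carried along because \<open>swap_W\<close> asks for it at
        every swap.\<close>
      have "[] @ y \<in> X \<and> v ([] @ y) \<in> W"
      proof (rule adjacent_swaps_closed[where xs = x])
        fix as bs :: "nat list" and a b
        assume h: "as @ a # b # bs \<in> X \<and> v (as @ a # b # bs) \<in> W"
        have "length as + 1 \<in> J"
          using len[OF conjunct1[OF h]] by (simp add: J_def)
        then show "as @ b # a # bs \<in> X \<and> v (as @ b # a # bs) \<in> W"
          using h swap_X swap_W swap_coords_append by metis
      qed (use x that in \<open>simp_all add: X\<close>)
      then show ?thesis
        by simp
    qed
    then have "span (v ` X) \<subseteq> W"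
      by (intro span_minimal W(1)) auto
    then show ?thesis
      using spans by blast
  qed
  have "v z \<noteq> 0"
    using ortho[OF z z] ip_diff_left[of 0 0 "v z"] by auto
  then have "(UNIV :: 'v set) \<noteq> {0}"
    by blast
  then show ?thesis
    using assms(7) all unfolding irreducible_braid_representation_def by blast
qed

end
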